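(* Let $[a,b]\subset\mathbb{R}$, $x_0\in[a,b]$, let $p_1,p_2,q,r_{11},r_{12},r_{21},r_{22}:[a,b]\to\mathbb{C}$ be continuous, and let $\lambda\in\mathbb{C}$. Put $B=\begin{pmatrix} 0 & 1 \\ -1 & 0 \end{pmatrix}$, $P=\begin{pmatrix} p_1 & q \\ q & p_2 \end{pmatrix}$, $R=\begin{pmatrix} r_{11} & r_{12} \\ r_{21} & r_{22} \end{pmatrix}$. Suppose that the homogeneous system $BY'+P(x)Y=0$ possesses a solution $Y_0=(f,g)^T$ on $[a,b]$ such that both functions $f$ and $g$ are non-vanishing on $[a,b]$. Let $X^{(n)},Y^{(n)},\widetilde X^{(n)},\widetilde Y^{(n)}$, $n\ge 0$, be the formal powers constructed from $(f,g)$ and $x_0$ as in the context. Then the general solution of the system $$B\frac{dY}{dx}+P(x)Y=\lambda R(x)Y$$ on $[a,b]$ has the form $Y=c_1Y_1+c_2Y_2$, where $c_1,c_2$ are arbitrary complex constants and $Y_1=(u_1,v_1)^T$, $Y_2=(u_2,v_2)^T$ are given by $$\begin{pmatrix} u_1 \\ v_1 \end{pmatrix}=\sum_{n=0}^\infty\frac{\lambda^n}{n!}\begin{pmatrix} f\widetilde X^{(n)} \\ g\widetilde Y^{(n)} \end{pmatrix},\qquad \begin{pmatrix} u_2 \\ v_2 \end{pmatrix}=\sum_{n=0}^\infty\frac{\lambda^n}{n!}\begin{pmatrix} fX^{(n)} \\ g Y^{(n)} \end{pmatrix}.$$ Both series converge uniformly on $[a,b]$. The solutions $Y_1$ and $Y_2$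 satisfy the initial conditions $$Y_1(x_0)=\begin{pmatrix} f(x_0) \\ 0 \end{pmatrix},\qquad Y_2(x_0)=\begin{pmatrix} 0 \\ g(x_0) \end{pmatrix}.$$
   Context: Formal powers. Given $f,g$ non-vanishing on $[a,b]$ and $x_0\in[a,b]$, define $$X^{(0)}(x)=f(x_0)g(x_0)\int_{x_0}^x\frac{p_2(s)}{f^2(s)}\,ds,\qquad Y^{(0)}(x)=1+f(x_0)g(x_0)\int_{x_0}^x\frac{p_1(s)}{g^2(s)}\,ds,$$ and recursively for $n\ge0$ $$Z^{(n)}(x)=\int_{x_0}^x\Bigl(X^{(n)}(s)\bigl(f^2(s)r_{11}(s)+g^2(s)r_{21}(s)\bigr)+Y^{(n)}(s)\bigl(f^2(s)r_{12}(s)+g^2(s)r_{22}(s)\bigr)\Bigr)ds,$$ $$X^{(n+1)}(x)=(n+1)\int_{x_0}^x\Bigl(-r_{21}(s)X^{(n)}(s)-r_{22}(s)\frac{g(s)}{f(s)}Y^{(n)}(s)+\frac{p_2(s)}{f^2(s)}Z^{(n)}(s)\Bigr)ds,$$ $$Y^{(n+1)}(x)=(n+1)\int_{x_0}^x\Bigl(r_{11}(s)\frac{f(s)}{g(s)}X^{(n)}(s)+r_{12}(s)Y^{(n)}(s)+\frac{p_1(s)}{g^2(s)}Z^{(n)}(s)\Bigr)ds.$$ Similarly set $$\widetilde X^{(0)}(x)=1-f(x_0)g(x_0)\int_{x_0}^x\frac{p_2(s)}{f^2(s)}\,ds,\qquad \widetilde Y^{(0)}(x)=-f(x_0)g(x_0)\int_{x_0}^x\frac{p_1(s)}{g^2(s)}\,ds,$$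 and define $\widetilde Z^{(n)},\widetilde X^{(n+1)},\widetilde Y^{(n+1)}$, $n\ge0$, by the same recursive formulas with $X^{(n)},Y^{(n)},Z^{(n)}$ replaced by $\widetilde X^{(n)},\widetilde Y^{(n)},\widetilde Z^{(n)}$. Solutions of systems are continuously differentiable functions $[a,b]\to\mathbb{C}^2$. The superscript in $Y^{(n)}$ is an index (scalar function), not a derivative.
   Formalization: In the definition of Z^(n) the terms g^2 r_21 and f^2 r_12 are replaced by f g r_21 and f g r_12; with the printed formula the series do not solve the system in general (e.g. p_2=r_12=1, all other coefficients 0, f=2x+1, g=2, x_0=0). *)

theory Defs
  imports "HOL-Analysis.Analysis"
begin

definition mat22 :: "complex \<Rightarrow> complex \<Rightarrow> complex \<Rightarrow> complex \<Rightarrow> complex^2^2" where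
  "mat22 m11 m12 m21 m22 = vector [vector [m11, m12], vector [m21, m22]]"

definition B :: "complex^2^2" where
  "B = mat22 0 1 (-1) 0"

text \<open>Continuously differentiable solutions on \<open>[a,b]\<close> of \<open>B Y' + P(x) Y = F(x, Y)\<close>.
  Derivatives at the end points are one-sided.\<close>

definition solves_system ::
  "real \<Rightarrow> real \<Rightarrow> (real \<Rightarrow> complex^2^2) \<Rightarrow> (real \<Rightarrow> complex^2 \<Rightarrow> complex^2)
    \<Rightarrow> (real \<Rightarrow> complex^2) \<Rightarrow> bool" where
  "solves_system a b P F Y \<longleftrightarrow>
     (\<exists>Y'. continuous_on {a..b} Y' \<and>
       (\<forall>x\<in>{a..b}. (Y has_vector_derivative Y' x) (at x within {a..b}) \<and>
          B *v Y' x + P x *v Y x = F x (Y x)))"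

text \<open>The entries \<open>p1\<close>, \<open>p2\<close> are \<open>P s $ 1 $ 1\<close>, \<open>P s $ 2 $ 2\<close>, and \<open>r_ij\<close> is \<open>R s $ i $ j\<close>.
  All integrals are oriented: \<open>LBINT s=x0..x\<close> changes sign when \<open>x < x0\<close>.

  In \<open>powers_Z\<close> the off-diagonal entries \<open>r12\<close>, \<open>r21\<close> carry the factor \<open>f g\<close>. Substituting
  \<open>u = f X\<close>, \<open>v = g Y\<close> into \<open>B (u,v)' + P (u,v) = \<lambda> R (u,v)\<close> gives
  \<open>(f g (Y - X))' = \<lambda> (X (f^2 r11 + f g r21) + Y (f g r12 + g^2 r22))\<close>.
  The formula also appears in print with \<open>g^2 r21\<close> and \<open>f^2 r12\<close> in place of \<open>f g r21\<close> and
  \<open>f g r12\<close>; that is a misprint, for which the series do not solve the system.\<close>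

definition powers_Z ::
  "(real \<Rightarrow> complex) \<Rightarrow> (real \<Rightarrow> complex) \<Rightarrow> (real \<Rightarrow> complex^2^2) \<Rightarrow> real
    \<Rightarrow> (real \<Rightarrow> complex) \<Rightarrow> (real \<Rightarrow> complex) \<Rightarrow> real \<Rightarrow> complex" where
  "powers_Z f g R x0 X Y x =
     (LBINT s=x0..x.
        X s * ((f s)\<^sup>2 * R s $ 1 $ 1 + f s * g s * R s $ 2 $ 1)
      + Y s * (f s * g s * R s $ 1 $ 2 + (g s)\<^sup>2 * R s $ 2 $ 2))"

primrec powers_XY ::
  "(real \<Rightarrow> complex) \<Rightarrow> (real \<Rightarrow> complex) \<Rightarrow> (real \<Rightarrow> complex^2^2) \<Rightarrow> (real \<Rightarrow> complex^2^2) \<Rightarrow> real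
    \<Rightarrow> (real \<Rightarrow> complex) \<Rightarrow> (real \<Rightarrow> complex) \<Rightarrow> nat
    \<Rightarrow> (real \<Rightarrow> complex) \<times> (real \<Rightarrow> complex)" where
  "powers_XY f g P R x0 X0 Y0 0 = (X0, Y0)"
| "powers_XY f g P R x0 X0 Y0 (Suc n) =
     (let X = fst (powers_XY f g P R x0 X0 Y0 n);
          Y = snd (powers_XY f g P R x0 X0 Y0 n);
          Z = powers_Z f g R x0 X Y
      in (\<lambda>x. of_nat (n + 1) *
             (LBINT s=x0..x. - R s $ 2 $ 1 * X s - R s $ 2 $ 2 * (g s / f s) * Y s
                             + P s $ 2 $ 2 / (f s)\<^sup>2 * Z s),
          \<lambda>x. of_nat (n + 1) *
             (LBINT s=x0..x. R s $ 1 $ 1 * (f s / g s) * X s + R s $ 1 $ 2 * Y s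
                             + P s $ 1 $ 1 / (g s)\<^sup>2 * Z s)))"

text \<open>The pairs \<open>(X^(n), Y^(n))\<close> and, with suffix \<open>_tilde\<close>, their tilde counterparts.\<close>

definition formal_powers ::
  "(real \<Rightarrow> complex) \<Rightarrow> (real \<Rightarrow> complex) \<Rightarrow> (real \<Rightarrow> complex^2^2) \<Rightarrow> (real \<Rightarrow> complex^2^2) \<Rightarrow> real
    \<Rightarrow> nat \<Rightarrow> (real \<Rightarrow> complex) \<times> (real \<Rightarrow> complex)" where
  "formal_powers f g P R x0 =
     powers_XY f g P R x0
       (\<lambda>x. f x0 * g x0 * (LBINT s=x0..x. P s $ 2 $ 2 / (f s)\<^sup>2))
       (\<lambda>x. 1 + f x0 * g x0 * (LBINT s=x0..x. P s $ 1 $ 1 / (g s)\<^sup>2))"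

definition formal_powers_tilde ::
  "(real \<Rightarrow> complex) \<Rightarrow> (real \<Rightarrow> complex) \<Rightarrow> (real \<Rightarrow> complex^2^2) \<Rightarrow> (real \<Rightarrow> complex^2^2) \<Rightarrow> real
    \<Rightarrow> nat \<Rightarrow> (real \<Rightarrow> complex) \<times> (real \<Rightarrow> complex)" where
  "formal_powers_tilde f g P R x0 =
     powers_XY f g P R x0
       (\<lambda>x. 1 - f x0 * g x0 * (LBINT s=x0..x. P s $ 2 $ 2 / (f s)\<^sup>2))
       (\<lambda>x. - (f x0 * g x0 * (LBINT s=x0..x. P s $ 1 $ 1 / (g s)\<^sup>2)))"

definition series_term ::
  "complex \<Rightarrow> (real \<Rightarrow> complex) \<Rightarrow> (real \<Rightarrow> complex)
    \<Rightarrow> (nat \<Rightarrow> (real \<Rightarrow> complex) \<times> (real \<Rightarrow> complex)) \<Rightarrow> nat \<Rightarrow> real \<Rightarrow> complex^2" where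
  "series_term lam f g W n x =
     (lam ^ n / fact n) *s vector [f x * fst (W n) x, g x * snd (W n) x]"

end

theory Submission
  imports Defs
begin

text \<open>
  Writing a solution as \<open>(f X, g Y)\<close>, the product rule turns the system into
  \<open>X' = p2 D / f^2 - lam (r21 X + r22 (g/f) Y)\<close> and \<open>Y' = p1 D / g^2 + lam (r11 (f/g) X + r12 Y)\<close>
  with \<open>D = f g (Y - X)\<close>. The power series \<open>X, Y, Z\<close> in \<open>lam\<close> built from the formal powers satisfy
  these equations with \<open>c + lam Z\<close> in place of \<open>D\<close>, where \<open>c = D(x0)\<close>. The difference
  \<open>D - (c + lam Z)\<close> solves a homogeneous scalar linear equation and vanishes at \<open>x0\<close>, hence everywhere.
  The bound \<open>M (K |x - x0|)^n\<close> on the \<open>n\<close>-th formal powers gives uniform convergence. Wronskians of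
  pairs of solutions solve one common scalar linear equation, so \<open>Y1, Y2\<close> are independent at every
  point and a solution vanishing at \<open>x0\<close> is zero.
\<close>

section \<open>Differential calculus of vector-valued functions on an interval\<close>

lemma continuous_on_of_has_vector_derivative:
  assumes "\<And>x. x \<in> S \<Longrightarrow> (h has_vector_derivative h' x) (at x within S)"
  shows "continuous_on S h"
  using assms by (meson has_vector_derivative_continuous continuous_on_eq_continuous_within)

text \<open>Coordinate projections are bounded linear, and so are the embeddings
  \<open>axis i\<close>, whose sum rebuilds a vector from its two entries.\<close>

lemma has_vector_derivative_vec2_iff:
  fixes Y :: "real \<Rightarrow> complex^2"
  shows "(Y has_vector_derivative Y') (at x within S) \<longleftrightarrow>
    ((\<lambda>x. Y x $ 1) has_vector_derivative Y' $ 1) (at x within S) \<and>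
    ((\<lambda>x. Y x $ 2) has_vector_derivative Y' $ 2) (at x within S)"
proof safe
  assume Y: "(Y has_vector_derivative Y') (at x within S)"
  show "((\<lambda>x. Y x $ 1) has_vector_derivative Y' $ 1) (at x within S)"
    "((\<lambda>x. Y x $ 2) has_vector_derivative Y' $ 2) (at x within S)"
    using bounded_linear.has_vector_derivative[OF bounded_linear_vec_nth Y] by blast+
next
  assume Y: "((\<lambda>x. Y x $ 1) has_vector_derivative Y' $ 1) (at x within S)"
    "((\<lambda>x. Y x $ 2) has_vector_derivative Y' $ 2) (at x within S)"
  have axis: "bounded_linear (axis i :: complex \<Rightarrow> complex^2)" for i :: 2
    by (intro linear_conv_bounded_linear[THEN iffD1] linearI)
      (auto simp: axis_def vec_eq_iff)
  have split: "v = axis 1 (v $ 1) + axis 2 (v $ 2)" for v :: "complex^2"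
    by (auto simp: axis_def vec_eq_iff forall_2)
  have "((\<lambda>x. axis 1 (Y x $ 1) + axis 2 (Y x $ 2) :: complex^2) has_vector_derivative
      axis 1 (Y' $ 1) + axis 2 (Y' $ 2)) (at x within S)"
    by (intro has_vector_derivative_add bounded_linear.has_vector_derivative[OF axis] Y)
  then show "(Y has_vector_derivative Y') (at x within S)"
    by (simp flip: split)
qed

text \<open>\<open>has_derivative_series\<close> asks that the derivative operators converge
  uniformly relative to \<open>norm h\<close>. For operators that scale a fixed vector by
  \<open>h\<close> this is uniform convergence of the vectors.\<close>

lemma has_vector_derivative_series:
  fixes F :: "nat \<Rightarrow> real \<Rightarrow> 'a::banach"
  assumes "convex S"
    and F: "\<And>n x. x \<in> S \<Longrightarrow> (F n has_vector_derivative F' n x) (at x within S)"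
    and lim: "uniform_limit S (\<lambda>n x. \<Sum>i<n. F' i x) G' sequentially"
    and "x0 \<in> S" "summable (\<lambda>n. F n x0)" "x \<in> S"
  shows "((\<lambda>x. \<Sum>n. F n x) has_vector_derivative G' x) (at x within S)"
proof -
  have "\<exists>G. \<forall>x\<in>S. (\<lambda>n. F n x) sums G x \<and> (G has_derivative (\<lambda>h. h *\<^sub>R G' x)) (at x within S)"
  proof (rule has_derivative_series[where f' = "\<lambda>n x h. h *\<^sub>R F' n x"])
    show "\<forall>\<^sub>F n in sequentially. \<forall>x\<in>S. \<forall>h.
        norm ((\<Sum>i<n. h *\<^sub>R F' i x) - h *\<^sub>R G' x) \<le> e * norm h" if "e > 0" for e
      using uniform_limitD[OF lim that]
    proof eventually_elim
      case (elim n)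
      have "norm ((\<Sum>i<n. h *\<^sub>R F' i x) - h *\<^sub>R G' x)
          = dist (\<Sum>i<n. F' i x) (G' x) * norm h" for x h
        by (simp add: dist_norm flip: scaleR_sum_right scaleR_diff_right)
      then show ?case
        using elim by (metis less_imp_le mult_right_mono norm_ge_zero)
    qed
  qed (use assms in \<open>auto simp: has_vector_derivative_def\<close>)
  then obtain G where G: "\<And>x. x \<in> S \<Longrightarrow> (\<lambda>n. F n x) sums G x"
      "\<And>x. x \<in> S \<Longrightarrow> (G has_vector_derivative G' x) (at x within S)"
    unfolding has_vector_derivative_def by blast
  \<comment> \<open>The limit \<open>G\<close> agrees with the infinite sum on \<open>S\<close>,
    which is enough for a derivative within \<open>S\<close>.\<close>
  show ?thesis
    by (rule has_vector_derivative_transform[OF \<open>x \<in> S\<close> _ G(2)[OF \<open>x \<in> S\<close>]])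
      (simp add: sums_unique[OF G(1)])
qed

text \<open>Mean value inequality against a multiple of a power of the distance to
  \<open>x0\<close>, on each side of \<open>x0\<close> separately. The factor \<open>Suc n\<close>
  allowed in the hypothesis matches the factor \<open>n + 1\<close> in the recursion, so the formal
  powers grow only geometrically in \<open>n\<close>.\<close>

lemma norm_le_power_of_derivative_le:
  fixes h :: "real \<Rightarrow> 'a::real_normed_vector"
  assumes x0: "x0 \<in> {a..b}" and h0: "h x0 = 0"
    and h: "\<And>s. s \<in> {a..b} \<Longrightarrow> (h has_vector_derivative h' s) (at s within {a..b})"
    and bound: "\<And>s. s \<in> {a..b} \<Longrightarrow> norm (h' s) \<le> C * real (Suc n) * \<bar>s - x0\<bar> ^ n"
    and x: "x \<in> {a..b}"
  shows "norm (h x) \<le> C * \<bar>x - x0\<bar> ^ Suc n"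
proof -
  have cont: "continuous_on {a..b} h"
    by (rule continuous_on_of_has_vector_derivative) (rule h)
  \<comment> \<open>Two-sided derivatives are available only in the interior; with continuity up to
    the end points this suffices for \<open>differentiable_bound_general\<close>.\<close>
  have h_at: "(h has_vector_derivative h' s) (at s)" if "a < s" "s < b" for s
    using h[of s] that by (simp add: at_within_Icc_at)
  consider "x = x0" | "x0 < x" | "x < x0" by linarith
  then show ?thesis
  proof cases
    case 1
    then show ?thesis using h0 by simp
  next
    case 2
    have "norm (h x - h x0) \<le> C * (x - x0) ^ Suc n - C * (x0 - x0) ^ Suc n"
    proof (rule differentiable_bound_general[OF 2])
      show "continuous_on {x0..x} h"
        using cont x x0 by (auto intro: continuous_on_subset)
      show "((\<lambda>x. C * (x - x0) ^ Suc n) has_vector_derivative C * real (Suc n) * (s - x0) ^ n) (at s)" for s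
        unfolding has_real_derivative_iff_has_vector_derivative[symmetric]
        by (rule derivative_eq_intros refl | simp)+
      show "norm (h' s) \<le> C * real (Suc n) * (s - x0) ^ n" if "x0 < s" "s < x" for s
        using bound[of s] that x x0 by simp
    qed (use h_at x x0 in \<open>auto intro!: continuous_intros\<close>)
    then show ?thesis using 2 h0 by simp
  next
    case 3
    \<comment> \<open>To the left of \<open>x0\<close> the comparison function is
      \<open>- C * (x0 - x) ^ Suc n\<close>; the sign makes its derivative the required bound on
      \<open>norm (h' s)\<close>.\<close>
    have "norm (h x0 - h x) \<le> - C * (x0 - x0) ^ Suc n - - C * (x0 - x) ^ Suc n"
    proof (rule differentiable_bound_general[OF 3])
      show "continuous_on {x..x0} h"
        using cont x x0 by (auto intro: continuous_on_subset)
      show "((\<lambda>x. - C * (x0 - x) ^ Suc n) has_vector_derivative C * real (Suc n) * (x0 - s) ^ n) (at s)" for s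
        unfolding has_real_derivative_iff_has_vector_derivative[symmetric]
        by (rule derivative_eq_intros refl | simp)+
      show "norm (h' s) \<le> C * real (Suc n) * (x0 - s) ^ n" if "x < s" "s < x0" for s
        using bound[of s] that x x0 by simp
    qed (use h_at x x0 in \<open>auto intro!: continuous_intros\<close>)
    then show ?thesis using 3 h0 by simp
  qed
qed

lemma LBINT_has_vector_derivative:
  fixes h :: "real \<Rightarrow> complex"
  assumes "x0 \<in> {a..b}" "continuous_on {a..b} h" "x \<in> {a..b}"
  shows "((\<lambda>x. LBINT s=x0..x. h s) has_vector_derivative h x) (at x within {a..b})"
  using interval_integral_FTC2[of a x0 b h x] assms by simp

section \<open>Series with coefficients \<open>lam ^ n / fact n\<close> and their termwise
  derivatives\<close>

text \<open>The factorial beats geometric growth: an exponential series in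
  \<open>norm lam * Q\<close> is a majorant for every \<open>lam\<close>, and the Weierstrass test
  applies.\<close>

lemma exp_series_majorized:
  fixes h :: "nat \<Rightarrow> real \<Rightarrow> complex"
  assumes "\<And>n x. x \<in> S \<Longrightarrow> norm (h n x) \<le> M * Q ^ n"
  shows "uniform_limit S (\<lambda>N x. \<Sum>n<N. lam ^ n / fact n * h n x)
      (\<lambda>x. \<Sum>n. lam ^ n / fact n * h n x) sequentially"
    and "x \<in> S \<Longrightarrow> summable (\<lambda>n. lam ^ n / fact n * h n x)"
proof -
  define c where "c n = M * ((norm lam * Q) ^ n /\<^sub>R fact n)" for n
  have c: "summable c"
    unfolding c_def by (intro summable_mult summable_exp_generic)
  have bound: "norm (lam ^ n / fact n * h n x) \<le> c n" if "x \<in> S" for n x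
  proof -
    have "norm (lam ^ n / fact n * h n x) \<le> norm lam ^ n / fact n * (M * Q ^ n)"
      unfolding norm_mult norm_divide norm_power norm_fact
      by (intro mult_left_mono assms that) auto
    also have "\<dots> = c n"
      by (simp add: c_def power_mult_distrib divide_simps)
    finally show ?thesis .
  qed
  show "uniform_limit S (\<lambda>N x. \<Sum>n<N. lam ^ n / fact n * h n x)
      (\<lambda>x. \<Sum>n. lam ^ n / fact n * h n x) sequentially"
    by (rule Weierstrass_m_test[OF bound c])
  show "summable (\<lambda>n. lam ^ n / fact n * h n x)" if "x \<in> S"
    by (rule summable_comparison_test'[OF c]) (rule bound[OF that])
qed

lemma exp_series_has_vector_derivative:
  fixes h d :: "nat \<Rightarrow> real \<Rightarrow> complex"
  assumes S: "convex S" and x: "x \<in> S"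
    and h: "\<And>n x. x \<in> S \<Longrightarrow> (h n has_vector_derivative d n x) (at x within S)"
    and bh: "\<And>n x. x \<in> S \<Longrightarrow> norm (h n x) \<le> M * Q ^ n"
    and bd: "\<And>n x. x \<in> S \<Longrightarrow> norm (d n x) \<le> M * Q ^ n"
  shows "((\<lambda>x. \<Sum>n. lam ^ n / fact n * h n x) has_vector_derivative
    (\<Sum>n. lam ^ n / fact n * d n x)) (at x within S)"
proof (rule has_vector_derivative_series[OF S _ exp_series_majorized(1)[OF bd] x _ x])
  show "((\<lambda>x. lam ^ n / fact n * h n x) has_vector_derivative lam ^ n / fact n * d n x) (at x within S)"
    if "x \<in> S" for n x
    by (intro has_vector_derivative_mult_right h that)
qed (use exp_series_majorized(2)[OF bh x] in simp_all)

text \<open>The factor \<open>Suc n\<close> cancels against \<open>fact (Suc n)\<close>, so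
  differentiation lowers the index by one and brings out a factor \<open>lam\<close>. The term of
  index 0 is split off because the recursion does not produce it.\<close>

lemma exp_series_shift_has_vector_derivative:
  fixes h d :: "nat \<Rightarrow> real \<Rightarrow> complex"
  assumes S: "convex S" and x: "x \<in> S"
    and h0: "(h 0 has_vector_derivative d0) (at x within S)"
    and h: "\<And>n x. x \<in> S \<Longrightarrow> (h (Suc n) has_vector_derivative of_nat (Suc n) * d n x) (at x within S)"
    and bh: "\<And>n x. x \<in> S \<Longrightarrow> norm (h n x) \<le> M * Q ^ n"
    and bd: "\<And>n x. x \<in> S \<Longrightarrow> norm (d n x) \<le> M * Q ^ n"
  shows "((\<lambda>x. \<Sum>n. lam ^ n / fact n * h n x) has_vector_derivative
    d0 + lam * (\<Sum>n. lam ^ n / fact n * d n x)) (at x within S)"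
proof -
  define F where "F n x = lam ^ Suc n / fact (Suc n) * h (Suc n) x" for n x
  have sum_h: "summable (\<lambda>n. lam ^ n / fact n * h n x)" if "x \<in> S" for x
    using exp_series_majorized(2)[OF bh that] by simp
  have F: "(F n has_vector_derivative lam * (lam ^ n / fact n * d n x)) (at x within S)"
    if "x \<in> S" for n x
  proof -
    have "(F n has_vector_derivative
        lam ^ Suc n / fact (Suc n) * (of_nat (Suc n) * d n x)) (at x within S)"
      unfolding F_def by (intro has_vector_derivative_mult_right h that)
    also have "lam ^ Suc n / fact (Suc n) * (of_nat (Suc n) * d n x) = lam * (lam ^ n / fact n * d n x)"
      by (simp add: field_simps del: of_nat_Suc)
    finally show ?thesis .
  qed
  have "((\<lambda>x. \<Sum>n. F n x) has_vector_derivative lam * (\<Sum>n. lam ^ n / fact n * d n x)) (at x within S)"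
  proof (rule has_vector_derivative_series[OF S F _ x _ x])
    show "uniform_limit S (\<lambda>N x. \<Sum>n<N. lam * (lam ^ n / fact n * d n x))
        (\<lambda>x. lam * (\<Sum>n. lam ^ n / fact n * d n x)) sequentially"
      unfolding sum_distrib_left[symmetric]
      by (rule bounded_linear.uniform_limit[OF bounded_linear_mult_right exp_series_majorized(1)[OF bd]])
    show "summable (\<lambda>n. F n x)"
      unfolding F_def using sum_h[OF x] by (subst summable_Suc_iff)
  qed
  then have "((\<lambda>x. h 0 x + (\<Sum>n. F n x)) has_vector_derivative
      d0 + lam * (\<Sum>n. lam ^ n / fact n * d n x)) (at x within S)"
    by (intro has_vector_derivative_add h0)
  moreover have "(\<Sum>n. lam ^ n / fact n * h n x) = h 0 x + (\<Sum>n. F n x)" if "x \<in> S" for x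
    using suminf_split_head[OF sum_h[OF that]] by (simp add: F_def)
  ultimately show ?thesis
    by (rule has_vector_derivative_transform[OF x, rotated])
qed

lemma finitely_many_continuous_bound:
  fixes hs :: "('a::metric_space \<Rightarrow> 'b::real_normed_vector) list"
  assumes "compact A" "\<forall>h\<in>set hs. continuous_on A h"
  shows "\<exists>B\<ge>0. \<forall>h\<in>set hs. \<forall>x\<in>A. norm (h x) \<le> B"
  using assms(2)
proof (induction hs)
  case (Cons h hs)
  then obtain B where B: "B \<ge> 0" "\<forall>h\<in>set hs. \<forall>x\<in>A. norm (h x) \<le> B" by auto
  obtain C where C: "C \<ge> 0" "\<And>x. x \<in> A \<Longrightarrow> norm (h x) \<le> C"
    using continuous_on_compact_bound[OF assms(1), of h] Cons.prems by auto
  show ?case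
    using B C by (intro exI[of _ "max B C"]) (auto simp: le_max_iff_disj)
qed auto

text \<open>Integrating factor. Two consequences are used: a solution that vanishes at
  \<open>x0\<close> vanishes everywhere, and one that does not vanish there vanishes
  nowhere.\<close>

lemma linear_ode_eq_exp:
  fixes \<phi> t :: "real \<Rightarrow> complex"
  assumes x0: "x0 \<in> {a..b}" and t: "continuous_on {a..b} t"
    and \<phi>: "\<And>x. x \<in> {a..b} \<Longrightarrow> (\<phi> has_vector_derivative t x * \<phi> x) (at x within {a..b})"
    and x: "x \<in> {a..b}"
  shows "\<phi> x = \<phi> x0 * exp (LBINT s=x0..x. t s)"
proof -
  define T where "T x = (LBINT s=x0..x. t s)" for x :: real
  have "((\<lambda>x. \<phi> x * exp (- T x)) has_vector_derivative 0) (at x within {a..b})"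
    if x: "x \<in> {a..b}" for x
  proof -
    have "((\<lambda>x. - T x) has_vector_derivative - t x) (at x within {a..b})"
      unfolding T_def by (intro has_vector_derivative_minus LBINT_has_vector_derivative x0 t x)
    from field_vector_diff_chain_within[OF this, of exp "exp (- T x)"]
    have "((\<lambda>x. exp (- T x)) has_vector_derivative - t x * exp (- T x)) (at x within {a..b})"
      by (simp add: o_def has_field_derivative_at_within)
    from has_vector_derivative_mult[OF \<phi>[OF x] this] show ?thesis
      by (simp add: algebra_simps)
  qed
  from has_vector_derivative_zero_constant[OF _ this]
  obtain c where c: "\<And>x. x \<in> {a..b} \<Longrightarrow> \<phi> x * exp (- T x) = c"
    by auto
  have "\<phi> x * exp (- T x) = \<phi> x0"
    using c[OF x] c[OF x0] by (simp add: T_def)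
  then show ?thesis
    by (simp add: T_def exp_minus field_simps)
qed

subsection \<open>The system in components\<close>

lemma mat22_nth [simp]:
  "mat22 m11 m12 m21 m22 $ 1 $ 1 = m11" "mat22 m11 m12 m21 m22 $ 1 $ 2 = m12"
  "mat22 m11 m12 m21 m22 $ 2 $ 1 = m21" "mat22 m11 m12 m21 m22 $ 2 $ 2 = m22"
  by (simp_all add: mat22_def)

text \<open>\<open>B\<close> maps \<open>(y1, y2)\<close> to \<open>(y2, - y1)\<close>. Hence the
  second row of the system determines the derivative of the first entry, and the first row that of
  the second entry.\<close>

definition linear_rhs1 :: "complex^2^2 \<Rightarrow> complex^2^2 \<Rightarrow> complex \<Rightarrow> complex^2 \<Rightarrow> complex" where
  "linear_rhs1 P R lam y =
    (P $ 2 $ 1 - lam * R $ 2 $ 1) * y $ 1 + (P $ 2 $ 2 - lam * R $ 2 $ 2) * y $ 2"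

definition linear_rhs2 :: "complex^2^2 \<Rightarrow> complex^2^2 \<Rightarrow> complex \<Rightarrow> complex^2 \<Rightarrow> complex" where
  "linear_rhs2 P R lam y =
    - (P $ 1 $ 1 - lam * R $ 1 $ 1) * y $ 1 - (P $ 1 $ 2 - lam * R $ 1 $ 2) * y $ 2"

text \<open>The explicit form in entries suits the product rule. Continuity of the derivative is not
  demanded; \<open>solves_system_iff\<close> recovers it.\<close>

definition system_solution ::
  "real set \<Rightarrow> (real \<Rightarrow> complex^2^2) \<Rightarrow> (real \<Rightarrow> complex^2^2) \<Rightarrow> complex \<Rightarrow> (real \<Rightarrow> complex^2) \<Rightarrow> bool"
where
  "system_solution S P R lam Y \<longleftrightarrow> (\<forall>x\<in>S.
      ((\<lambda>x. Y x $ 1) has_vector_derivative linear_rhs1 (P x) (R x) lam (Y x)) (at x within S) \<and>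
      ((\<lambda>x. Y x $ 2) has_vector_derivative linear_rhs2 (P x) (R x) lam (Y x)) (at x within S))"

text \<open>\<open>B\<close> is invertible, so the system prescribes the derivative, which is
  continuous because \<open>Y\<close> and the coefficients are.\<close>

lemma solves_system_iff:
  assumes P: "\<And>i j. continuous_on {a..b} (\<lambda>x. P x $ i $ j)"
    and R: "\<And>i j. continuous_on {a..b} (\<lambda>x. R x $ i $ j)"
  shows "solves_system a b P (\<lambda>x Y. lam *s (R x *v Y)) Y \<longleftrightarrow>
    system_solution {a..b} P R lam Y"
proof -
  define rhs where
    "rhs x = (vector [linear_rhs1 (P x) (R x) lam (Y x), linear_rhs2 (P x) (R x) lam (Y x)] :: complex^2)" for x
  have alg: "B *v y' + P x *v Y x = lam *s (R x *v Y x) \<longleftrightarrow> y' = rhs x" for x y'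
    by (auto simp: vec_eq_iff forall_2 matrix_vector_mult_def sum_2 B_def rhs_def
        linear_rhs1_def linear_rhs2_def algebra_simps)
  have "solves_system a b P (\<lambda>x Y. lam *s (R x *v Y)) Y \<longleftrightarrow>
      (\<forall>x\<in>{a..b}. (Y has_vector_derivative rhs x) (at x within {a..b}))"
  proof
    assume "solves_system a b P (\<lambda>x Y. lam *s (R x *v Y)) Y"
    then show "\<forall>x\<in>{a..b}. (Y has_vector_derivative rhs x) (at x within {a..b})"
      unfolding solves_system_def alg by auto
  next
    assume Y: "\<forall>x\<in>{a..b}. (Y has_vector_derivative rhs x) (at x within {a..b})"
    then have "continuous_on {a..b} Y"
      by (auto intro: continuous_on_of_has_vector_derivative)
    then have "continuous_on {a..b} (\<lambda>x. rhs x $ i)" for i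
      using exhaust_2[of i]
      by (elim disjE) (simp_all add: rhs_def linear_rhs1_def linear_rhs2_def continuous_intros P R)
    then have "continuous_on {a..b} (\<lambda>x. \<chi> i. rhs x $ i)"
      by (rule continuous_on_vec_lambda)
    then have "continuous_on {a..b} rhs" by simp
    with Y show "solves_system a b P (\<lambda>x Y. lam *s (R x *v Y)) Y"
      unfolding solves_system_def alg by auto
  qed
  also have "\<dots> \<longleftrightarrow> system_solution {a..b} P R lam Y"
    by (simp add: system_solution_def has_vector_derivative_vec2_iff rhs_def)
  finally show ?thesis .
qed

lemma system_solution_linear_combination:
  assumes "system_solution S P R lam Y" "system_solution S P R lam Z"
  shows "system_solution S P R lam (\<lambda>x. c *s Y x + d *s Z x)"
proof -
  have "linear_rhs1 (P x) (R x) lam (c *s Y x + d *s Z x)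
      = c * linear_rhs1 (P x) (R x) lam (Y x) + d * linear_rhs1 (P x) (R x) lam (Z x)"
    "linear_rhs2 (P x) (R x) lam (c *s Y x + d *s Z x)
      = c * linear_rhs2 (P x) (R x) lam (Y x) + d * linear_rhs2 (P x) (R x) lam (Z x)" for x
    by (simp_all add: linear_rhs1_def linear_rhs2_def algebra_simps)
  with assms show ?thesis
    unfolding system_solution_def
    by (auto intro!: has_vector_derivative_add has_vector_derivative_mult_right)
qed

text \<open>A derivative within \<open>S\<close> depends only on values on \<open>S\<close>. This
  matters because the closed form of the series is known on the interval only.\<close>

lemma system_solution_transform:
  assumes Y: "system_solution S P R lam Y" and eq: "\<And>x. x \<in> S \<Longrightarrow> Z x = Y x"
  shows "system_solution S P R lam Z"
  unfolding system_solution_def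
proof (intro ballI conjI)
  fix x assume x: "x \<in> S"
  show "((\<lambda>x. Z x $ 1) has_vector_derivative linear_rhs1 (P x) (R x) lam (Z x)) (at x within S)"
    using Y x unfolding system_solution_def eq[OF x]
    by (intro has_vector_derivative_transform[OF x, of "\<lambda>x. Z x $ 1" "\<lambda>x. Y x $ 1"]) (simp_all add: eq)
  show "((\<lambda>x. Z x $ 2) has_vector_derivative linear_rhs2 (P x) (R x) lam (Z x)) (at x within S)"
    using Y x unfolding system_solution_def eq[OF x]
    by (intro has_vector_derivative_transform[OF x, of "\<lambda>x. Z x $ 2" "\<lambda>x. Y x $ 2"]) (simp_all add: eq)
qed

section \<open>Wronskians and the two-dimensional solution space\<close>

text \<open>Liouville's formula: the Wronskian solves a scalar linear equation whose coefficient is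
  the trace of the explicit system. The exponential factor is thus the same for all pairs of
  solutions and never zero.\<close>

lemma wronskian_eq_exp:
  assumes P: "\<And>i j. continuous_on {a..b} (\<lambda>x. P x $ i $ j)"
    and R: "\<And>i j. continuous_on {a..b} (\<lambda>x. R x $ i $ j)"
    and Y: "system_solution {a..b} P R lam Y" and Z: "system_solution {a..b} P R lam Z"
    and x0: "x0 \<in> {a..b}" and x: "x \<in> {a..b}"
  shows "Y x $ 1 * Z x $ 2 - Z x $ 1 * Y x $ 2 = (Y x0 $ 1 * Z x0 $ 2 - Z x0 $ 1 * Y x0 $ 2) *
    exp (LBINT s=x0..x. P s $ 2 $ 1 - lam * R s $ 2 $ 1 - (P s $ 1 $ 2 - lam * R s $ 1 $ 2))"
proof (rule linear_ode_eq_exp[OF x0 _ _ x])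
  fix x assume x: "x \<in> {a..b}"
  note Y = Y[unfolded system_solution_def, rule_format, OF x]
  note Z = Z[unfolded system_solution_def, rule_format, OF x]
  have "((\<lambda>x. Y x $ 1 * Z x $ 2 - Z x $ 1 * Y x $ 2) has_vector_derivative
     (Y x $ 1 * linear_rhs2 (P x) (R x) lam (Z x) + linear_rhs1 (P x) (R x) lam (Y x) * Z x $ 2)
     - (Z x $ 1 * linear_rhs2 (P x) (R x) lam (Y x) + linear_rhs1 (P x) (R x) lam (Z x) * Y x $ 2))
     (at x within {a..b})"
    using Y Z by (intro has_vector_derivative_diff has_vector_derivative_mult) auto
  then show "((\<lambda>x. Y x $ 1 * Z x $ 2 - Z x $ 1 * Y x $ 2) has_vector_derivative
     (P x $ 2 $ 1 - lam * R x $ 2 $ 1 - (P x $ 1 $ 2 - lam * R x $ 1 $ 2)) *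
     (Y x $ 1 * Z x $ 2 - Z x $ 1 * Y x $ 2)) (at x within {a..b})"
    by (simp add: linear_rhs1_def linear_rhs2_def algebra_simps)
qed (intro continuous_intros P R)

text \<open>Subtracting the combination that matches \<open>Y\<close> at \<open>x0\<close> leaves a
  solution \<open>V\<close> with \<open>V x0 = 0\<close>. Its Wronskians with \<open>Y1\<close> and
  \<open>Y2\<close> vanish on the interval, while that of \<open>Y1\<close> and \<open>Y2\<close>
  vanishes nowhere, which forces \<open>V\<close> to be zero there.\<close>

lemma system_solution_iff_linear_combination:
  assumes P: "\<And>i j. continuous_on {a..b} (\<lambda>x. P x $ i $ j)"
    and R: "\<And>i j. continuous_on {a..b} (\<lambda>x. R x $ i $ j)"
    and Y1: "system_solution {a..b} P R lam Y1" and Y2: "system_solution {a..b} P R lam Y2"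
    and x0: "x0 \<in> {a..b}"
    and init1: "Y1 x0 = vector [u, 0]" "u \<noteq> 0" and init2: "Y2 x0 = vector [0, v]" "v \<noteq> 0"
  shows "system_solution {a..b} P R lam Y \<longleftrightarrow>
    (\<exists>c1 c2. \<forall>x\<in>{a..b}. Y x = c1 *s Y1 x + c2 *s Y2 x)"
proof
  assume "\<exists>c1 c2. \<forall>x\<in>{a..b}. Y x = c1 *s Y1 x + c2 *s Y2 x"
  then show "system_solution {a..b} P R lam Y"
    using system_solution_transform[OF system_solution_linear_combination[OF Y1 Y2]] by blast
next
  assume Y: "system_solution {a..b} P R lam Y"
  define c1 where "c1 = Y x0 $ 1 / u"
  define c2 where "c2 = Y x0 $ 2 / v"
  \<comment> \<open>The scalars \<open>1\<close> and \<open>-1\<close> give the difference the shape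
    of \<open>system_solution_linear_combination\<close>.\<close>
  define V where "V x = 1 *s Y x + (-1) *s (c1 *s Y1 x + c2 *s Y2 x)" for x
  have V: "system_solution {a..b} P R lam V"
    unfolding V_def by (intro system_solution_linear_combination Y Y1 Y2)
  have V0: "V x0 = 0"
    using init1 init2 by (simp add: V_def c1_def c2_def vec_eq_iff forall_2)
  have "V x = 0" if x: "x \<in> {a..b}" for x
  proof -
    have e1: "V x $ 1 * Y1 x $ 2 = Y1 x $ 1 * V x $ 2"
      using wronskian_eq_exp[OF P R V Y1 x0 x] V0 by simp
    have e2: "V x $ 1 * Y2 x $ 2 = Y2 x $ 1 * V x $ 2"
      using wronskian_eq_exp[OF P R V Y2 x0 x] V0 by simp
    have W: "Y1 x $ 1 * Y2 x $ 2 - Y2 x $ 1 * Y1 x $ 2 \<noteq> 0"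
      using wronskian_eq_exp[OF P R Y1 Y2 x0 x] init1 init2 by simp
    \<comment> \<open>Cramer's rule: \<open>e1\<close> and \<open>e2\<close> form a homogeneous
      linear system for the entries of \<open>V x\<close> whose determinant is the Wronskian in
      \<open>W\<close>.\<close>
    have "V x $ 1 * (Y1 x $ 1 * Y2 x $ 2 - Y2 x $ 1 * Y1 x $ 2)
        = Y1 x $ 1 * (V x $ 1 * Y2 x $ 2) - Y2 x $ 1 * (V x $ 1 * Y1 x $ 2)"
      by (simp only: algebra_simps)
    also have "\<dots> = 0"
      unfolding e1 e2 by (simp add: mult_ac)
    finally have V1: "V x $ 1 = 0" using W by simp
    have "V x $ 2 * (Y1 x $ 1 * Y2 x $ 2 - Y2 x $ 1 * Y1 x $ 2)
        = Y2 x $ 2 * (Y1 x $ 1 * V x $ 2) - Y1 x $ 2 * (Y2 x $ 1 * V x $ 2)"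
      by (simp only: algebra_simps)
    also have "\<dots> = 0"
      unfolding e1[symmetric] e2[symmetric] by (simp add: mult_ac)
    finally have V2: "V x $ 2 = 0" using W by simp
    show ?thesis using V1 V2 by (simp add: vec_eq_iff forall_2)
  qed
  then have "\<forall>x\<in>{a..b}. Y x = c1 *s Y1 x + c2 *s Y2 x"
    by (simp add: V_def vec_eq_iff algebra_simps)
  then show "\<exists>c1 c2. \<forall>x\<in>{a..b}. Y x = c1 *s Y1 x + c2 *s Y2 x"
    by blast
qed

subsection \<open>Formal powers\<close>

text \<open>The two families differ only in the start \<open>(X0, Y0)\<close>: the constant \<open>c\<close> is \<open>f(x0) g(x0)\<close> for the
  formal powers and \<open>- f(x0) g(x0)\<close> for their tilde counterparts.\<close>

locale formal_power_recursion =
  fixes a b x0 :: real and f g :: "real \<Rightarrow> complex" and P R :: "real \<Rightarrow> complex^2^2"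
    and X0 Y0 :: "real \<Rightarrow> complex" and c :: complex
  assumes x0: "x0 \<in> {a..b}"
    and cont_P: "\<And>i j. continuous_on {a..b} (\<lambda>x. P x $ i $ j)"
    and cont_R: "\<And>i j. continuous_on {a..b} (\<lambda>x. R x $ i $ j)"
    and sym: "\<And>x. P x $ 2 $ 1 = P x $ 1 $ 2"
    and f: "\<And>x. x \<in> {a..b} \<Longrightarrow>
      (f has_vector_derivative P x $ 1 $ 2 * f x + P x $ 2 $ 2 * g x) (at x within {a..b})"
    and g: "\<And>x. x \<in> {a..b} \<Longrightarrow>
      (g has_vector_derivative - P x $ 1 $ 1 * f x - P x $ 1 $ 2 * g x) (at x within {a..b})"
    and f_nz: "\<And>x. x \<in> {a..b} \<Longrightarrow> f x \<noteq> 0" and g_nz: "\<And>x. x \<in> {a..b} \<Longrightarrow> g x \<noteq> 0"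
    and X0: "\<And>x. x \<in> {a..b} \<Longrightarrow>
      (X0 has_vector_derivative c * (P x $ 2 $ 2 / (f x)\<^sup>2)) (at x within {a..b})"
    and Y0: "\<And>x. x \<in> {a..b} \<Longrightarrow>
      (Y0 has_vector_derivative c * (P x $ 1 $ 1 / (g x)\<^sup>2)) (at x within {a..b})"
    and c: "c = f x0 * g x0 * (Y0 x0 - X0 x0)"
begin

abbreviation W :: "nat \<Rightarrow> (real \<Rightarrow> complex) \<times> (real \<Rightarrow> complex)" where
  "W \<equiv> powers_XY f g P R x0 X0 Y0"

definition X :: "nat \<Rightarrow> real \<Rightarrow> complex" where "X n = fst (W n)"
definition Y :: "nat \<Rightarrow> real \<Rightarrow> complex" where "Y n = snd (W n)"
definition Z :: "nat \<Rightarrow> real \<Rightarrow> complex" where "Z n = powers_Z f g R x0 (X n) (Y n)"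

text \<open>Up to the factor \<open>Suc n\<close> this is the derivative of
  \<open>X (Suc n)\<close>, not of \<open>X n\<close>. The index of \<open>dY\<close> is shifted
  likewise, while \<open>dZ n\<close> is the derivative of \<open>Z n\<close> itself.\<close>

definition dX :: "nat \<Rightarrow> real \<Rightarrow> complex" where
  "dX n s = - R s $ 2 $ 1 * X n s - R s $ 2 $ 2 * (g s / f s) * Y n s + P s $ 2 $ 2 / (f s)\<^sup>2 * Z n s"

definition dY :: "nat \<Rightarrow> real \<Rightarrow> complex" where
  "dY n s = R s $ 1 $ 1 * (f s / g s) * X n s + R s $ 1 $ 2 * Y n s + P s $ 1 $ 1 / (g s)\<^sup>2 * Z n s"

definition dZ :: "nat \<Rightarrow> real \<Rightarrow> complex" where
  "dZ n s = X n s * ((f s)\<^sup>2 * R s $ 1 $ 1 + f s * g s * R s $ 2 $ 1)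
          + Y n s * (f s * g s * R s $ 1 $ 2 + (g s)\<^sup>2 * R s $ 2 $ 2)"

lemma X_0: "X 0 = X0" and Y_0: "Y 0 = Y0"
  by (simp_all add: X_def Y_def)

lemma X_Suc: "X (Suc n) x = of_nat (Suc n) * (LBINT s=x0..x. dX n s)"
  and Y_Suc: "Y (Suc n) x = of_nat (Suc n) * (LBINT s=x0..x. dY n s)"
  unfolding dX_def dY_def Z_def by (simp_all add: X_def Y_def Let_def)

lemma Z_eq: "Z n x = (LBINT s=x0..x. dZ n s)"
  by (simp add: Z_def powers_Z_def dZ_def)

lemma at_x0: "X (Suc n) x0 = 0" "Y (Suc n) x0 = 0" "Z n x0 = 0"
  by (simp_all add: X_Suc Y_Suc Z_eq del: of_nat_Suc)

lemma cont_f: "continuous_on {a..b} f" and cont_g: "continuous_on {a..b} g"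
  by (rule continuous_on_of_has_vector_derivative, erule f g)+

lemmas continuous_on_coeff = continuous_on_add continuous_on_diff continuous_on_minus
  continuous_on_mult continuous_on_divide continuous_on_power cont_f cont_g cont_P cont_R

section \<open>Derivatives of the formal powers\<close>

text \<open>Fundamental theorem of calculus. Continuity is assumed here and in the next lemma
  because both feed the induction in \<open>continuous_XY\<close>, after which the assumption is
  discharged.\<close>

lemma Z_derivative_if_continuous:
  assumes "continuous_on {a..b} (X n)" "continuous_on {a..b} (Y n)"
  shows "x \<in> {a..b} \<Longrightarrow> (Z n has_vector_derivative dZ n x) (at x within {a..b})"
proof -
  have "continuous_on {a..b} (dZ n)"
    unfolding dZ_def by (intro continuous_on_coeff assms)
  from LBINT_has_vector_derivative[OF x0 this]
  show "x \<in> {a..b} \<Longrightarrow> (Z n has_vector_derivative dZ n x) (at x within {a..b})"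
    by (simp add: Z_eq[abs_def])
qed

lemma XY_Suc_derivative_if_continuous:
  assumes X: "continuous_on {a..b} (X n)" and Y: "continuous_on {a..b} (Y n)"
  shows "x \<in> {a..b} \<Longrightarrow> (X (Suc n) has_vector_derivative of_nat (Suc n) * dX n x) (at x within {a..b})"
    and "x \<in> {a..b} \<Longrightarrow> (Y (Suc n) has_vector_derivative of_nat (Suc n) * dY n x) (at x within {a..b})"
proof -
  have Z: "continuous_on {a..b} (Z n)"
    using Z_derivative_if_continuous[OF X Y] by (rule continuous_on_of_has_vector_derivative)
  have "continuous_on {a..b} (dX n)" "continuous_on {a..b} (dY n)"
    unfolding dX_def dY_def
    by (intro continuous_on_coeff X Y Z; use f_nz g_nz in simp)+
  note d = this[THEN LBINT_has_vector_derivative[OF x0]]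
  show "x \<in> {a..b} \<Longrightarrow> (X (Suc n) has_vector_derivative of_nat (Suc n) * dX n x) (at x within {a..b})"
    unfolding X_Suc[abs_def] by (intro has_vector_derivative_mult_right d)
  show "x \<in> {a..b} \<Longrightarrow> (Y (Suc n) has_vector_derivative of_nat (Suc n) * dY n x) (at x within {a..b})"
    unfolding Y_Suc[abs_def] by (intro has_vector_derivative_mult_right d)
qed

lemma continuous_XY: "continuous_on {a..b} (X n)" "continuous_on {a..b} (Y n)"
proof (induction n)
  case 0
  show "continuous_on {a..b} (X 0)" "continuous_on {a..b} (Y 0)"
    unfolding X_0 Y_0
    by (rule continuous_on_of_has_vector_derivative, erule X0 Y0)+
next
  case (Suc n)
  show "continuous_on {a..b} (X (Suc n))" "continuous_on {a..b} (Y (Suc n))"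
    by (rule continuous_on_of_has_vector_derivative, erule XY_Suc_derivative_if_continuous[OF Suc])+
qed

lemmas X_Suc_derivative = XY_Suc_derivative_if_continuous(1)[OF continuous_XY]
lemmas Y_Suc_derivative = XY_Suc_derivative_if_continuous(2)[OF continuous_XY]
lemmas Z_derivative = Z_derivative_if_continuous[OF continuous_XY]

section \<open>Geometric bounds for the formal powers\<close>

text \<open>Continuity on a compact interval; the quotients are continuous as \<open>f\<close> and
  \<open>g\<close> do not vanish. The eight functions are the coefficients in \<open>dX\<close>,
  \<open>dY\<close> and \<open>dZ\<close>.\<close>

lemma coefficient_bound:
  obtains B where "B \<ge> 0" "\<And>x. x \<in> {a..b} \<Longrightarrow>
    norm (R x $ 2 $ 1) \<le> B \<and>
    norm (R x $ 2 $ 2 * (g x / f x)) \<le> B \<and>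
    norm (P x $ 2 $ 2 / (f x)\<^sup>2) \<le> B \<and>
    norm (R x $ 1 $ 1 * (f x / g x)) \<le> B \<and>
    norm (R x $ 1 $ 2) \<le> B \<and>
    norm (P x $ 1 $ 1 / (g x)\<^sup>2) \<le> B \<and>
    norm ((f x)\<^sup>2 * R x $ 1 $ 1 + f x * g x * R x $ 2 $ 1) \<le> B \<and>
    norm (f x * g x * R x $ 1 $ 2 + (g x)\<^sup>2 * R x $ 2 $ 2) \<le> B"
proof -
  define hs where "hs = [\<lambda>x. R x $ 2 $ 1, \<lambda>x. R x $ 2 $ 2 * (g x / f x), \<lambda>x. P x $ 2 $ 2 / (f x)\<^sup>2,
    \<lambda>x. R x $ 1 $ 1 * (f x / g x), \<lambda>x. R x $ 1 $ 2, \<lambda>x. P x $ 1 $ 1 / (g x)\<^sup>2,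
    \<lambda>x. (f x)\<^sup>2 * R x $ 1 $ 1 + f x * g x * R x $ 2 $ 1,
    \<lambda>x. f x * g x * R x $ 1 $ 2 + (g x)\<^sup>2 * R x $ 2 $ 2]"
  have "\<forall>h\<in>set hs. continuous_on {a..b} h"
    unfolding hs_def list.set ball_simps
    by (intro conjI TrueI continuous_on_coeff; use f_nz g_nz in simp)
  from finitely_many_continuous_bound[OF compact_Icc this]
  obtain B where "B \<ge> 0" and B: "\<forall>h\<in>set hs. \<forall>x\<in>{a..b}. norm (h x) \<le> B" by blast
  then show ?thesis
    by (intro that[of B]) (simp_all add: hs_def)
qed

text \<open>Induction on the sharper bound \<open>M * K ^ n * \<bar>x - x0\<bar> ^ n\<close> for
  \<open>X n\<close> and \<open>Y n\<close>: integration divides by \<open>n + 1\<close> and so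
  cancels the factor of the recursion. A common \<open>M\<close> and \<open>Q\<close> for all six
  families fits the series lemmas.\<close>

lemma powers_bound:
  obtains M Q where
    "\<And>n x. x \<in> {a..b} \<Longrightarrow> norm (X n x) \<le> M * Q ^ n"
    "\<And>n x. x \<in> {a..b} \<Longrightarrow> norm (Y n x) \<le> M * Q ^ n"
    "\<And>n x. x \<in> {a..b} \<Longrightarrow> norm (Z n x) \<le> M * Q ^ n"
    "\<And>n x. x \<in> {a..b} \<Longrightarrow> norm (dX n x) \<le> M * Q ^ n"
    "\<And>n x. x \<in> {a..b} \<Longrightarrow> norm (dY n x) \<le> M * Q ^ n"
    "\<And>n x. x \<in> {a..b} \<Longrightarrow> norm (dZ n x) \<le> M * Q ^ n"
proof -
  obtain B where B0: "B \<ge> 0" and B: "\<And>x. x \<in> {a..b} \<Longrightarrow>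
    norm (R x $ 2 $ 1) \<le> B \<and>
    norm (R x $ 2 $ 2 * (g x / f x)) \<le> B \<and>
    norm (P x $ 2 $ 2 / (f x)\<^sup>2) \<le> B \<and>
    norm (R x $ 1 $ 1 * (f x / g x)) \<le> B \<and>
    norm (R x $ 1 $ 2) \<le> B \<and>
    norm (P x $ 1 $ 1 / (g x)\<^sup>2) \<le> B \<and>
    norm ((f x)\<^sup>2 * R x $ 1 $ 1 + f x * g x * R x $ 2 $ 1) \<le> B \<and>
    norm (f x * g x * R x $ 1 $ 2 + (g x)\<^sup>2 * R x $ 2 $ 2) \<le> B"
    using coefficient_bound by blast
  obtain M1 where M1: "M1 \<ge> 0" "\<And>x. x \<in> {a..b} \<Longrightarrow> norm (X 0 x) \<le> M1"
    using continuous_on_compact_bound[OF compact_Icc continuous_XY(1)] by blast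
  obtain M2 where M2: "M2 \<ge> 0" "\<And>x. x \<in> {a..b} \<Longrightarrow> norm (Y 0 x) \<le> M2"
    using continuous_on_compact_bound[OF compact_Icc continuous_XY(2)] by blast
  define M where "M = max M1 M2"
  have M0: "M \<ge> 0" using M1(1) by (simp add: M_def)
  define L where "L = b - a"
  \<comment> \<open>In \<open>dX\<close> and \<open>dY\<close> the terms with \<open>X\<close> and
    \<open>Y\<close> contribute \<open>B\<close> each, and the term with \<open>Z\<close>
    contributes \<open>B\<close> times the constant \<open>2 * B * L\<close> from the bound on
    \<open>Z\<close>.\<close>
  define K where "K = 2 * B + 2 * B * L * B"
  have L0: "L \<ge> 0" using x0 by (simp add: L_def)
  have K0: "K \<ge> 0" using B0 L0 by (simp add: K_def)
  have L: "\<bar>x - x0\<bar> \<le> L" if "x \<in> {a..b}" for x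
    using x0 that by (auto simp: L_def)
  have dZ_le: "norm (dZ n x) \<le> 2 * B * e"
    if "x \<in> {a..b}" "norm (X n x) \<le> e" "norm (Y n x) \<le> e" for n x e
  proof -
    have "e \<ge> 0" using that(2) norm_ge_zero order_trans by blast
    then have "norm (dZ n x) \<le> e * B + e * B"
      unfolding dZ_def using that B[OF that(1)] B0
      by (intro norm_triangle_le add_mono) (auto simp: norm_mult simp del: norm_triangle_ineq intro!: mult_mono)
    then show ?thesis by simp
  qed
  have dXY_le: "norm (dX n x) \<le> K * e" "norm (dY n x) \<le> K * e"
    if "x \<in> {a..b}" "norm (X n x) \<le> e" "norm (Y n x) \<le> e" "norm (Z n x) \<le> 2 * B * L * e" for n x e
  proof -
    have e: "e \<ge> 0" using that(2) norm_ge_zero order_trans by blast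
    have m: "norm (u * v) \<le> B * d" if "norm u \<le> B" "norm v \<le> d" for u v :: complex and d
      unfolding norm_mult using that B0 by (intro mult_mono) auto
    have "norm (dX n x) \<le> B * e + B * e + B * (2 * B * L * e)"
      unfolding dX_def using that B[OF that(1)]
      by (intro norm_triangle_le norm_triangle_le_diff add_mono m) auto
    then show "norm (dX n x) \<le> K * e" by (simp add: K_def algebra_simps)
    have "norm (dY n x) \<le> B * e + B * e + B * (2 * B * L * e)"
      unfolding dY_def using that B[OF that(1)]
      by (intro norm_triangle_le norm_triangle_le_diff add_mono m) auto
    then show "norm (dY n x) \<le> K * e" by (simp add: K_def algebra_simps)
  qed
  have Z_le: "norm (Z n x) \<le> 2 * B * L * (M * K ^ n * \<bar>x - x0\<bar> ^ n)"
    if XY: "\<And>x. x \<in> {a..b} \<Longrightarrow> norm (X n x) \<le> M * K ^ n * \<bar>x - x0\<bar> ^ n"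
      "\<And>x. x \<in> {a..b} \<Longrightarrow> norm (Y n x) \<le> M * K ^ n * \<bar>x - x0\<bar> ^ n" and x: "x \<in> {a..b}" for n x
  proof -
    have "norm (Z n x) \<le> 2 * B * M * K ^ n * \<bar>x - x0\<bar> ^ Suc n"
    proof (rule norm_le_power_of_derivative_le[OF x0 at_x0(3) Z_derivative _ x])
      fix s assume s: "s \<in> {a..b}"
      have "norm (dZ n s) \<le> 2 * B * (M * K ^ n * \<bar>s - x0\<bar> ^ n)"
        by (rule dZ_le[OF s XY[OF s]])
      \<comment> \<open>Unlike \<open>X\<close> and \<open>Y\<close>, \<open>Z\<close> has no factor
        \<open>n + 1\<close> in its definition; the factor is inserted only to fit the comparison
        lemma.\<close>
      also have "\<dots> \<le> 2 * B * (M * K ^ n * \<bar>s - x0\<bar> ^ n) * real (Suc n)"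
        using mult_left_mono[of 1 "real (Suc n)" "2 * B * (M * K ^ n * \<bar>s - x0\<bar> ^ n)"] B0 M0 K0
        by simp
      finally show "norm (dZ n s) \<le> 2 * B * M * K ^ n * real (Suc n) * \<bar>s - x0\<bar> ^ n"
        by (simp add: mult_ac)
    qed
    also have "\<dots> = 2 * B * (M * K ^ n * \<bar>x - x0\<bar> ^ n) * \<bar>x - x0\<bar>" by simp
    \<comment> \<open>The extra power gained by integration is traded for the length
      \<open>L\<close>, so that \<open>Z n\<close> is bounded by the same power of the distance as
      \<open>X n\<close> and \<open>Y n\<close>.\<close>
    also have "\<dots> \<le> 2 * B * (M * K ^ n * \<bar>x - x0\<bar> ^ n) * L"
      using L[OF x] B0 M0 K0 by (intro mult_left_mono) auto
    finally show ?thesis by (simp add: mult_ac)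
  qed
  have XY: "(\<forall>x\<in>{a..b}. norm (X n x) \<le> M * K ^ n * \<bar>x - x0\<bar> ^ n) \<and>
      (\<forall>x\<in>{a..b}. norm (Y n x) \<le> M * K ^ n * \<bar>x - x0\<bar> ^ n)" for n
  proof (induction n)
    case 0
    \<comment> \<open>Since \<open>0 ^ 0 = 1\<close>, the bound for index 0 is \<open>M\<close> at
      \<open>x0\<close> as well.\<close>
    show ?case using M1 M2 by (auto simp: M_def le_max_iff_disj)
  next
    case (Suc n)
    then have IH: "\<And>x. x \<in> {a..b} \<Longrightarrow> norm (X n x) \<le> M * K ^ n * \<bar>x - x0\<bar> ^ n"
      "\<And>x. x \<in> {a..b} \<Longrightarrow> norm (Y n x) \<le> M * K ^ n * \<bar>x - x0\<bar> ^ n" by auto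
    have d: "norm (of_nat (Suc n) * dX n s) \<le> M * K ^ Suc n * real (Suc n) * \<bar>s - x0\<bar> ^ n"
      "norm (of_nat (Suc n) * dY n s) \<le> M * K ^ Suc n * real (Suc n) * \<bar>s - x0\<bar> ^ n"
      if s: "s \<in> {a..b}" for s
      using dXY_le[OF s IH[OF s] Z_le[OF IH s], THEN mult_left_mono[where c = "real (Suc n)"]]
      by (simp_all add: norm_mult mult_ac del: of_nat_Suc)
    show ?case
      using norm_le_power_of_derivative_le[OF x0 at_x0(1) X_Suc_derivative d(1)]
        norm_le_power_of_derivative_le[OF x0 at_x0(2) Y_Suc_derivative d(2)] by blast
  qed
  define Q where "Q = K * L"
  \<comment> \<open>The sum dominates each of the constants \<open>1\<close>, \<open>K\<close>,
    \<open>2 * B * L\<close> and \<open>2 * B\<close> that occur for the six families.\<close>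
  define M' where "M' = M * (1 + K + 2 * B * L + 2 * B)"
  have pow: "M * K ^ n * \<bar>x - x0\<bar> ^ n \<le> M * Q ^ n" if "x \<in> {a..b}" for n x
    using M0 K0 L[OF that] unfolding Q_def power_mult_distrib mult.assoc
    by (intro mult_left_mono power_mono) auto
  have X: "norm (X n x) \<le> M * Q ^ n" and Y: "norm (Y n x) \<le> M * Q ^ n"
    if "x \<in> {a..b}" for n x
    using XY[of n] pow[OF that, of n] that by (meson order_trans)+
  have Z: "norm (Z n x) \<le> 2 * B * L * (M * Q ^ n)" if x: "x \<in> {a..b}" for n x
  proof -
    have "norm (Z n x) \<le> 2 * B * L * (M * K ^ n * \<bar>x - x0\<bar> ^ n)"
      using XY[of n] x by (intro Z_le) auto
    also have "\<dots> \<le> 2 * B * L * (M * Q ^ n)"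
      using B0 L0 by (intro mult_left_mono pow x) auto
    finally show ?thesis .
  qed
  have MQ: "0 \<le> M * Q ^ n" for n using M0 K0 L0 by (simp add: Q_def)
  have M': "k * (M * Q ^ n) \<le> M' * Q ^ n" if "k \<le> 1 + K + 2 * B * L + 2 * B" for k n
    using mult_right_mono[OF that MQ[of n]] by (simp add: M'_def mult_ac)
  show ?thesis
  proof (rule that)
    fix n x assume x: "x \<in> {a..b}"
    show "norm (X n x) \<le> M' * Q ^ n" "norm (Y n x) \<le> M' * Q ^ n"
      using K0 B0 L0 M'[of 1 n] order_trans[OF X[OF x]] order_trans[OF Y[OF x]] by simp_all
    show "norm (Z n x) \<le> M' * Q ^ n"
      using K0 B0 L0 by (intro order_trans[OF Z[OF x] M']) simp
    show "norm (dX n x) \<le> M' * Q ^ n"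
      using K0 B0 L0 by (intro order_trans[OF dXY_le(1)[OF x X[OF x] Y[OF x] Z[OF x]] M']) simp
    show "norm (dY n x) \<le> M' * Q ^ n"
      using K0 B0 L0 by (intro order_trans[OF dXY_le(2)[OF x X[OF x] Y[OF x] Z[OF x]] M']) simp
    show "norm (dZ n x) \<le> M' * Q ^ n"
      using K0 B0 L0 by (intro order_trans[OF dZ_le[OF x X[OF x] Y[OF x]] M']) simp
  qed
qed

section \<open>Convergence of the series and the system it solves\<close>

definition series :: "complex \<Rightarrow> real \<Rightarrow> complex^2" where
  "series lam x = (\<Sum>n. series_term lam f g W n x)"

lemma series_term_nth:
  "series_term lam f g W n x $ 1 = f x * (lam ^ n / fact n * X n x)"
  "series_term lam f g W n x $ 2 = g x * (lam ^ n / fact n * Y n x)"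
  by (simp_all add: series_term_def X_def Y_def)

text \<open>Weierstrass test for vectors: the norm is at most the sum of the norms of the entries,
  and \<open>f\<close> and \<open>g\<close> are bounded by compactness.\<close>

lemma uniform_limit_series:
  "uniform_limit {a..b} (\<lambda>N x. \<Sum>n<N. series_term lam f g W n x) (series lam) sequentially"
  and summable_series_term: "x \<in> {a..b} \<Longrightarrow> summable (\<lambda>n. series_term lam f g W n x)"
proof -
  obtain M Q where bX: "\<And>n x. x \<in> {a..b} \<Longrightarrow> norm (X n x) \<le> M * Q ^ n"
    and bY: "\<And>n x. x \<in> {a..b} \<Longrightarrow> norm (Y n x) \<le> M * Q ^ n"
    using powers_bound by metis
  obtain F where F: "F \<ge> 0" "\<And>x. x \<in> {a..b} \<Longrightarrow> norm (f x) \<le> F"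
    using continuous_on_compact_bound[OF compact_Icc cont_f] by blast
  obtain G where G: "G \<ge> 0" "\<And>x. x \<in> {a..b} \<Longrightarrow> norm (g x) \<le> G"
    using continuous_on_compact_bound[OF compact_Icc cont_g] by blast
  define m where "m n = (F + G) * M * ((norm lam * Q) ^ n /\<^sub>R fact n)" for n
  have m: "summable m"
    unfolding m_def by (intro summable_mult summable_exp_generic)
  have bound: "norm (series_term lam f g W n x) \<le> m n" if x: "x \<in> {a..b}" for n x
  proof -
    have "norm (series_term lam f g W n x)
        \<le> norm (series_term lam f g W n x $ 1) + norm (series_term lam f g W n x $ 2)"
      unfolding norm_vec_def[of "series_term lam f g W n x"]
      by (rule order_trans[OF L2_set_le_sum]) (auto simp: sum_2)
    also have "\<dots> \<le> F * (norm lam ^ n / fact n * (M * Q ^ n)) + G * (norm lam ^ n / fact n * (M * Q ^ n))"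
      unfolding series_term_nth norm_mult norm_divide norm_power norm_fact
      by (intro add_mono mult_mono F G bX bY x) auto
    also have "\<dots> = m n"
      by (simp add: m_def power_mult_distrib divide_simps algebra_simps)
    finally show ?thesis .
  qed
  show "uniform_limit {a..b} (\<lambda>N x. \<Sum>n<N. series_term lam f g W n x) (series lam) sequentially"
    unfolding series_def[abs_def] by (rule Weierstrass_m_test[OF bound m])
  show "summable (\<lambda>n. series_term lam f g W n x)" if "x \<in> {a..b}"
    by (rule summable_comparison_test'[OF m]) (rule bound[OF that])
qed

text \<open>Both claims rest on the same expression of the series through the sums of the
  \<open>X n\<close> and the \<open>Y n\<close>.\<close>

lemma series_solution:
  "system_solution {a..b} P R lam (series lam)" (is ?solution)
  and series_at_x0: "series lam x0 = vector [f x0 * X0 x0, g x0 * Y0 x0]"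
proof -
  obtain M Q where
    bX: "\<And>n x. x \<in> {a..b} \<Longrightarrow> norm (X n x) \<le> M * Q ^ n" and
    bY: "\<And>n x. x \<in> {a..b} \<Longrightarrow> norm (Y n x) \<le> M * Q ^ n" and
    bZ: "\<And>n x. x \<in> {a..b} \<Longrightarrow> norm (Z n x) \<le> M * Q ^ n" and
    bdX: "\<And>n x. x \<in> {a..b} \<Longrightarrow> norm (dX n x) \<le> M * Q ^ n" and
    bdY: "\<And>n x. x \<in> {a..b} \<Longrightarrow> norm (dY n x) \<le> M * Q ^ n" and
    bdZ: "\<And>n x. x \<in> {a..b} \<Longrightarrow> norm (dZ n x) \<le> M * Q ^ n"
    using powers_bound by blast
  define \<Sigma> where "\<Sigma> h x = (\<Sum>n. lam ^ n / fact n * h n x)" for h :: "nat \<Rightarrow> real \<Rightarrow> complex" and x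
  have sums: "(\<lambda>n. lam ^ n / fact n * h n x) sums \<Sigma> h x"
    if "x \<in> {a..b}" "\<And>n x. x \<in> {a..b} \<Longrightarrow> norm (h n x) \<le> M * Q ^ n" for h x
    unfolding \<Sigma>_def
    by (rule summable_sums, rule exp_series_majorized(2)[where S = "{a..b}"]) (use that in auto)
  note sX = sums[OF _ bX] and sY = sums[OF _ bY] and sZ = sums[OF _ bZ]

  \<comment> \<open>At fixed \<open>x\<close> the coefficients do not depend on \<open>n\<close> and
    can be taken out of the sums.\<close>
  have dX_eq: "\<Sigma> dX x = - R x $ 2 $ 1 * \<Sigma> X x - R x $ 2 $ 2 * (g x / f x) * \<Sigma> Y x
      + P x $ 2 $ 2 / (f x)\<^sup>2 * \<Sigma> Z x" if x: "x \<in> {a..b}" for x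
    using sums_add[OF sums_diff[OF sums_mult[OF sX[OF x], where c = "- R x $ 2 $ 1"]
          sums_mult[OF sY[OF x], where c = "R x $ 2 $ 2 * (g x / f x)"]]
          sums_mult[OF sZ[OF x], where c = "P x $ 2 $ 2 / (f x)\<^sup>2"]]
    by (subst \<Sigma>_def, intro sums_unique[symmetric])
      (simp add: dX_def algebra_simps)
  have dY_eq: "\<Sigma> dY x = R x $ 1 $ 1 * (f x / g x) * \<Sigma> X x + R x $ 1 $ 2 * \<Sigma> Y x
      + P x $ 1 $ 1 / (g x)\<^sup>2 * \<Sigma> Z x" if x: "x \<in> {a..b}" for x
    using sums_add[OF sums_add[OF sums_mult[OF sX[OF x], where c = "R x $ 1 $ 1 * (f x / g x)"]
          sums_mult[OF sY[OF x], where c = "R x $ 1 $ 2"]]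
          sums_mult[OF sZ[OF x], where c = "P x $ 1 $ 1 / (g x)\<^sup>2"]]
    by (subst \<Sigma>_def, intro sums_unique[symmetric])
      (simp add: dY_def algebra_simps)
  have dZ_eq: "\<Sigma> dZ x = \<Sigma> X x * ((f x)\<^sup>2 * R x $ 1 $ 1 + f x * g x * R x $ 2 $ 1)
          + \<Sigma> Y x * (f x * g x * R x $ 1 $ 2 + (g x)\<^sup>2 * R x $ 2 $ 2)" if x: "x \<in> {a..b}" for x
    using sums_add[OF sums_mult2[OF sX[OF x], where c = "(f x)\<^sup>2 * R x $ 1 $ 1 + f x * g x * R x $ 2 $ 1"]
          sums_mult2[OF sY[OF x], where c = "f x * g x * R x $ 1 $ 2 + (g x)\<^sup>2 * R x $ 2 $ 2"]]
    by (subst \<Sigma>_def, intro sums_unique[symmetric])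
      (simp add: dZ_def algebra_simps)

  \<comment> \<open>The summand with \<open>c\<close> is the derivative of \<open>X 0\<close>;
    together with the part of \<open>lam * \<Sigma> dX x\<close> that contains
    \<open>\<Sigma> Z x\<close> it yields the factor \<open>c + lam * \<Sigma> Z x\<close>.\<close>
  have DX: "(\<Sigma> X has_vector_derivative c * (P x $ 2 $ 2 / (f x)\<^sup>2) + lam * \<Sigma> dX x) (at x within {a..b})"
    if x: "x \<in> {a..b}" for x
    unfolding \<Sigma>_def[abs_def]
    by (rule exp_series_shift_has_vector_derivative[OF convex_real_interval(5) x _ X_Suc_derivative bX bdX])
      (simp_all only: X_0 X0[OF x])
  have DY: "(\<Sigma> Y has_vector_derivative c * (P x $ 1 $ 1 / (g x)\<^sup>2) + lam * \<Sigma> dY x) (at x within {a..b})"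
    if x: "x \<in> {a..b}" for x
    unfolding \<Sigma>_def[abs_def]
    by (rule exp_series_shift_has_vector_derivative[OF convex_real_interval(5) x _ Y_Suc_derivative bY bdY])
      (simp_all only: Y_0 Y0[OF x])
  have DZ: "(\<Sigma> Z has_vector_derivative \<Sigma> dZ x) (at x within {a..b})" if x: "x \<in> {a..b}" for x
    unfolding \<Sigma>_def[abs_def]
    by (rule exp_series_has_vector_derivative[OF convex_real_interval(5) x Z_derivative bZ bdZ])

  have at_x0: "\<Sigma> X x0 = X0 x0" "\<Sigma> Y x0 = Y0 x0" "\<Sigma> Z x0 = 0"
  proof -
    \<comment> \<open>Powers of positive index are integrals from \<open>x0\<close>, so only index 0
      survives there.\<close>
    have "X n x0 = 0" "Y n x0 = 0" if "n \<notin> {0}" for n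
      using that at_x0(1,2)[of "n - 1"] by simp_all
    then show "\<Sigma> X x0 = X0 x0" "\<Sigma> Y x0 = Y0 x0"
      unfolding \<Sigma>_def by (subst suminf_finite[of "{0}"]; simp add: X_0 Y_0)+
    show "\<Sigma> Z x0 = 0"
      by (simp add: \<Sigma>_def at_x0)
  qed

  define H where "H x = f x * g x * (\<Sigma> Y x - \<Sigma> X x) - (c + lam * \<Sigma> Z x)" for x
  \<comment> \<open>This is the logarithmic derivative of \<open>f * g\<close>: the off-diagonal
    entries of \<open>P\<close> cancel in the product rule.\<close>
  define t where "t x = (P x $ 2 $ 2 * (g x)\<^sup>2 - P x $ 1 $ 1 * (f x)\<^sup>2) / (f x * g x)" for x
  have "(H has_vector_derivative t x * H x) (at x within {a..b})" if x: "x \<in> {a..b}" for x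
  proof -
    have "(H has_vector_derivative
        (f x * g x * ((c * (P x $ 1 $ 1 / (g x)\<^sup>2) + lam * \<Sigma> dY x) - (c * (P x $ 2 $ 2 / (f x)\<^sup>2) + lam * \<Sigma> dX x))
          + (f x * (- P x $ 1 $ 1 * f x - P x $ 1 $ 2 * g x) + (P x $ 1 $ 2 * f x + P x $ 2 $ 2 * g x) * g x)
            * (\<Sigma> Y x - \<Sigma> X x))
        - (0 + lam * \<Sigma> dZ x)) (at x within {a..b})"
      unfolding H_def[abs_def]
      by (intro has_vector_derivative_diff has_vector_derivative_mult has_vector_derivative_add
          has_vector_derivative_const has_vector_derivative_mult_right DX DY DZ f g x)
    \<comment> \<open>All entries of \<open>R\<close> cancel: those in
      \<open>f * g * (\<Sigma> dY - \<Sigma> dX)\<close> are exactly those of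
      \<open>\<Sigma> dZ\<close>. This is where \<open>r12\<close> and \<open>r21\<close> must carry
      the weight \<open>f * g\<close> in \<open>powers_Z\<close>.\<close>
    also have "(f x * g x * ((c * (P x $ 1 $ 1 / (g x)\<^sup>2) + lam * \<Sigma> dY x) - (c * (P x $ 2 $ 2 / (f x)\<^sup>2) + lam * \<Sigma> dX x))
          + (f x * (- P x $ 1 $ 1 * f x - P x $ 1 $ 2 * g x) + (P x $ 1 $ 2 * f x + P x $ 2 $ 2 * g x) * g x)
            * (\<Sigma> Y x - \<Sigma> X x))
        - (0 + lam * \<Sigma> dZ x) = t x * H x"
      unfolding dX_eq[OF x] dY_eq[OF x] dZ_eq[OF x] t_def H_def
      using f_nz[OF x] g_nz[OF x] by (simp add: field_simps power2_eq_square)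
    finally show ?thesis .
  qed
  moreover have "continuous_on {a..b} t"
    unfolding t_def by (intro continuous_on_coeff; use f_nz g_nz in simp)
  moreover have "H x0 = 0"
    by (simp add: H_def at_x0 c)
  ultimately have "H x = 0" if "x \<in> {a..b}" for x
    using linear_ode_eq_exp[OF x0, of t H x] that by simp
  then have H: "c + lam * \<Sigma> Z x = f x * g x * (\<Sigma> Y x - \<Sigma> X x)" if "x \<in> {a..b}" for x
    using that by (simp add: H_def)

  have series_eq: "series lam x = vector [f x * \<Sigma> X x, g x * \<Sigma> Y x]" if x: "x \<in> {a..b}" for x
  proof -
    have s: "(\<lambda>n. series_term lam f g W n x) sums series lam x"
      unfolding series_def by (rule summable_sums[OF summable_series_term[OF x]])
    have "series lam x $ 1 = f x * \<Sigma> X x"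
      using sums_vec_nth[OF s, of 1] sums_mult[OF sX[OF x], where c = "f x"]
      unfolding series_term_nth by (rule sums_unique2)
    moreover have "series lam x $ 2 = g x * \<Sigma> Y x"
      using sums_vec_nth[OF s, of 2] sums_mult[OF sY[OF x], where c = "g x"]
      unfolding series_term_nth by (rule sums_unique2)
    ultimately show ?thesis by (simp add: vec_eq_iff forall_2)
  qed
  then show "series lam x0 = vector [f x0 * X0 x0, g x0 * Y0 x0]"
    using x0 at_x0 by simp

  have "system_solution {a..b} P R lam (\<lambda>x. vector [f x * \<Sigma> X x, g x * \<Sigma> Y x])"
    unfolding system_solution_def vector_2
  proof (intro ballI conjI)
    fix x assume x: "x \<in> {a..b}"
    \<comment> \<open>Grouping by \<open>c + lam * \<Sigma> Z x\<close> makes \<open>H\<close>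
      applicable. Multiplied by \<open>f x\<close>, that term becomes
      \<open>P x $ 2 $ 2 * g x * (\<Sigma> Y x - \<Sigma> X x)\<close>, whose part with
      \<open>\<Sigma> X x\<close> cancels against the derivative of \<open>f\<close>.\<close>
    have dX: "c * (P x $ 2 $ 2 / (f x)\<^sup>2) + lam * \<Sigma> dX x
        = P x $ 2 $ 2 / (f x)\<^sup>2 * (c + lam * \<Sigma> Z x)
          - lam * (R x $ 2 $ 1 * \<Sigma> X x + R x $ 2 $ 2 * (g x / f x) * \<Sigma> Y x)"
      unfolding dX_eq[OF x] by (simp add: algebra_simps add_divide_distrib)
    have "f x * (c * (P x $ 2 $ 2 / (f x)\<^sup>2) + lam * \<Sigma> dX x)
        + (P x $ 1 $ 2 * f x + P x $ 2 $ 2 * g x) * \<Sigma> X x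
        = linear_rhs1 (P x) (R x) lam (vector [f x * \<Sigma> X x, g x * \<Sigma> Y x])"
      unfolding dX H[OF x] linear_rhs1_def vector_2 sym
      using f_nz[OF x] by (simp add: field_simps power2_eq_square)
    then show "((\<lambda>x. f x * \<Sigma> X x) has_vector_derivative
        linear_rhs1 (P x) (R x) lam (vector [f x * \<Sigma> X x, g x * \<Sigma> Y x])) (at x within {a..b})"
      using has_vector_derivative_mult[OF f[OF x] DX[OF x]] by simp
    have dY: "c * (P x $ 1 $ 1 / (g x)\<^sup>2) + lam * \<Sigma> dY x
        = P x $ 1 $ 1 / (g x)\<^sup>2 * (c + lam * \<Sigma> Z x)
          + lam * (R x $ 1 $ 1 * (f x / g x) * \<Sigma> X x + R x $ 1 $ 2 * \<Sigma> Y x)"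
      unfolding dY_eq[OF x] by (simp add: algebra_simps add_divide_distrib)
    have "g x * (c * (P x $ 1 $ 1 / (g x)\<^sup>2) + lam * \<Sigma> dY x)
        + (- P x $ 1 $ 1 * f x - P x $ 1 $ 2 * g x) * \<Sigma> Y x
        = linear_rhs2 (P x) (R x) lam (vector [f x * \<Sigma> X x, g x * \<Sigma> Y x])"
      unfolding dY H[OF x] linear_rhs2_def vector_2
      using g_nz[OF x] by (simp add: field_simps power2_eq_square)
    then show "((\<lambda>x. g x * \<Sigma> Y x) has_vector_derivative
        linear_rhs2 (P x) (R x) lam (vector [f x * \<Sigma> X x, g x * \<Sigma> Y x])) (at x within {a..b})"
      using has_vector_derivative_mult[OF g[OF x] DY[OF x]] by simp
  qed
  then show ?solution
    by (rule system_solution_transform) (simp add: series_eq)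
qed

end

section \<open>The general solution from the two families of formal powers\<close>

theorem theorem2p2:
  fixes a b x0 :: real
    and p1 p2 q r11 r12 r21 r22 f g :: "real \<Rightarrow> complex"
    and lam :: complex
    and P R :: "real \<Rightarrow> complex^2^2"
    and Y1 Y2 :: "real \<Rightarrow> complex^2"
  assumes ab: "a < b" and x0: "x0 \<in> {a..b}"
    and cont_P: "continuous_on {a..b} p1" "continuous_on {a..b} p2" "continuous_on {a..b} q"
    and cont_R: "continuous_on {a..b} r11" "continuous_on {a..b} r12"
                "continuous_on {a..b} r21" "continuous_on {a..b} r22"
    and P: "P = (\<lambda>x. mat22 (p1 x) (q x) (q x) (p2 x))"
    and R: "R = (\<lambda>x. mat22 (r11 x) (r12 x) (r21 x) (r22 x))"
    and hom: "solves_system a b P (\<lambda>x Y. 0) (\<lambda>x. vector [f x, g x])"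
    and nonvanishing: "\<And>x. x \<in> {a..b} \<Longrightarrow> f x \<noteq> 0 \<and> g x \<noteq> 0"
    and Y1: "Y1 = (\<lambda>x. \<Sum>n. series_term lam f g (formal_powers_tilde f g P R x0) n x)"
    and Y2: "Y2 = (\<lambda>x. \<Sum>n. series_term lam f g (formal_powers f g P R x0) n x)"
  shows "(\<forall>Y. solves_system a b P (\<lambda>x Y. lam *s (R x *v Y)) Y \<longleftrightarrow>
            (\<exists>c1 c2. \<forall>x\<in>{a..b}. Y x = c1 *s Y1 x + c2 *s Y2 x))
    \<and> uniform_limit {a..b}
         (\<lambda>N x. \<Sum>n<N. series_term lam f g (formal_powers_tilde f g P R x0) n x) Y1 sequentially
    \<and> uniform_limit {a..b}
         (\<lambda>N x. \<Sum>n<N. series_term lam f g (formal_powers f g P R x0) n x) Y2 sequentially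
    \<and> Y1 x0 = vector [f x0, 0]
    \<and> Y2 x0 = vector [0, g x0]"
proof -
  have cP: "continuous_on {a..b} (\<lambda>x. P x $ i $ j)" for i j
    using exhaust_2[of i] exhaust_2[of j] cont_P by (elim disjE) (simp_all add: P)
  have cR: "continuous_on {a..b} (\<lambda>x. R x $ i $ j)" for i j
    using exhaust_2[of i] exhaust_2[of j] cont_R by (elim disjE) (simp_all add: R)
  note solves_iff = solves_system_iff[OF cP cR]
  \<comment> \<open>The homogeneous system is the case of spectral parameter 0, so
    \<open>solves_system_iff\<close> also yields the equations for \<open>f\<close> and
    \<open>g\<close>.\<close>
  have "solves_system a b P (\<lambda>x Y. 0 *s (R x *v Y)) (\<lambda>x. vector [f x, g x])"
    using hom by simp
  then have "system_solution {a..b} P R 0 (\<lambda>x. vector [f x, g x])"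
    by (simp only: solves_iff)
  then have fg:
    "(f has_vector_derivative P x $ 1 $ 2 * f x + P x $ 2 $ 2 * g x) (at x within {a..b})"
    "(g has_vector_derivative - P x $ 1 $ 1 * f x - P x $ 1 $ 2 * g x) (at x within {a..b})"
    if "x \<in> {a..b}" for x
    using that by (simp_all add: system_solution_def linear_rhs1_def linear_rhs2_def P)
  have nz: "f x \<noteq> 0" "g x \<noteq> 0" if "x \<in> {a..b}" for x
    using nonvanishing[OF that] by auto
  have cf: "continuous_on {a..b} f" and cg: "continuous_on {a..b} g"
    by (rule continuous_on_of_has_vector_derivative, erule fg)+
  define I2 where "I2 x = (LBINT s=x0..x. P s $ 2 $ 2 / (f s)\<^sup>2)" for x
  define I1 where "I1 x = (LBINT s=x0..x. P s $ 1 $ 1 / (g s)\<^sup>2)" for x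
  have I2: "(I2 has_vector_derivative P x $ 2 $ 2 / (f x)\<^sup>2) (at x within {a..b})"
    if x: "x \<in> {a..b}" for x
    unfolding I2_def[abs_def]
    by (rule LBINT_has_vector_derivative[OF x0 _ x])
      (intro continuous_on_divide continuous_on_power cP cf; use nz in simp)
  have I1: "(I1 has_vector_derivative P x $ 1 $ 1 / (g x)\<^sup>2) (at x within {a..b})"
    if x: "x \<in> {a..b}" for x
    unfolding I1_def[abs_def]
    by (rule LBINT_has_vector_derivative[OF x0 _ x])
      (intro continuous_on_divide continuous_on_power cP cg; use nz in simp)
  have I_x0: "I1 x0 = 0" "I2 x0 = 0" by (simp_all add: I1_def I2_def)
  define k where "k = f x0 * g x0"

  \<comment> \<open>The pair starts at \<open>(1, 0)\<close> in \<open>x0\<close>, hence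
    \<open>f * g * (Y0 - X0)\<close> equals \<open>- k\<close> there; the other family starts at
    \<open>(0, 1)\<close> and gives \<open>k\<close>.\<close>
  interpret tilde: formal_power_recursion a b x0 f g P R "\<lambda>x. 1 - k * I2 x" "\<lambda>x. - (k * I1 x)" "- k"
  proof
    fix x assume x: "x \<in> {a..b}"
    show "((\<lambda>x. 1 - k * I2 x) has_vector_derivative - k * (P x $ 2 $ 2 / (f x)\<^sup>2)) (at x within {a..b})"
      using has_vector_derivative_diff[OF has_vector_derivative_const has_vector_derivative_mult_right[OF I2[OF x]], of 1 k]
      by simp
    show "((\<lambda>x. - (k * I1 x)) has_vector_derivative - k * (P x $ 1 $ 1 / (g x)\<^sup>2)) (at x within {a..b})"
      using has_vector_derivative_minus[OF has_vector_derivative_mult_right[OF I1[OF x]], of k] by simp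
  qed (use x0 fg nz cP cR in \<open>simp_all add: I_x0 k_def P\<close>)

  interpret untilde: formal_power_recursion a b x0 f g P R "\<lambda>x. k * I2 x" "\<lambda>x. 1 + k * I1 x" k
  proof
    fix x assume x: "x \<in> {a..b}"
    show "((\<lambda>x. k * I2 x) has_vector_derivative k * (P x $ 2 $ 2 / (f x)\<^sup>2)) (at x within {a..b})"
      by (rule has_vector_derivative_mult_right[OF I2[OF x]])
    show "((\<lambda>x. 1 + k * I1 x) has_vector_derivative k * (P x $ 1 $ 1 / (g x)\<^sup>2)) (at x within {a..b})"
      using has_vector_derivative_add[OF has_vector_derivative_const has_vector_derivative_mult_right[OF I1[OF x]], of 1 k]
      by simp
  qed (use x0 fg nz cP cR in \<open>simp_all add: I_x0 k_def P\<close>)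

  have W1: "formal_powers_tilde f g P R x0 = tilde.W"
    by (simp add: formal_powers_tilde_def k_def I1_def I2_def)
  have W2: "formal_powers f g P R x0 = untilde.W"
    by (simp add: formal_powers_def k_def I1_def I2_def)
  have Y1_eq: "Y1 = tilde.series lam" and Y2_eq: "Y2 = untilde.series lam"
    unfolding Y1 Y2 W1 W2 tilde.series_def[abs_def] untilde.series_def[abs_def] by simp_all
  have init1: "Y1 x0 = vector [f x0, 0]" and init2: "Y2 x0 = vector [0, g x0]"
    unfolding Y1_eq Y2_eq tilde.series_at_x0 untilde.series_at_x0 by (simp_all add: I_x0)
  have sol1: "system_solution {a..b} P R lam Y1" and sol2: "system_solution {a..b} P R lam Y2"
    unfolding Y1_eq Y2_eq by (rule tilde.series_solution untilde.series_solution)+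
  show ?thesis
  proof (intro conjI allI)
    show "solves_system a b P (\<lambda>x Y. lam *s (R x *v Y)) Y \<longleftrightarrow>
        (\<exists>c1 c2. \<forall>x\<in>{a..b}. Y x = c1 *s Y1 x + c2 *s Y2 x)" for Y
      unfolding solves_iff
      by (rule system_solution_iff_linear_combination[OF cP cR sol1 sol2 x0 init1 _ init2])
        (use nz[OF x0] in auto)
    show "uniform_limit {a..b}
         (\<lambda>N x. \<Sum>n<N. series_term lam f g (formal_powers_tilde f g P R x0) n x) Y1 sequentially"
      unfolding W1 Y1_eq by (rule tilde.uniform_limit_series)
    show "uniform_limit {a..b}
         (\<lambda>N x. \<Sum>n<N. series_term lam f g (formal_powers f g P R x0) n x) Y2 sequentially"
      unfolding W2 Y2_eq by (rule untilde.uniform_limit_series)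
  qed (rule init1 init2)+
qed

end
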